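(* Let $m,m_0,p,q$ be positive integers with $m\ge m_0$ and $q>\min\{m_0,p\}$. Then $$\widetilde{F}_v(m;p;m-m_0+q) \le \widetilde{F}_v(m_0;p;q) + m - m_0.$$
   Context: All graphs are finite, simple, undirected. For a graph $G$, $G \overset{v}{\rightarrow} (a_1,\dots,a_s)$ means: for every coloring of $V(G)$ with $s$ colors there is an $i$ such that $G$ contains an $a_i$-clique all of whose vertices have color $i$. For positive integers $m,p$, write $G \overset{v}{\rightarrow} \langle m\rangle_p$ if $G \overset{v}{\rightarrow} (a_1,\dots,a_s)$ for every choice of positive integers $a_1,\dots,a_s$ ($s$ arbitrary) with $\sum_{i=1}^s(a_i-1)+1 = m$ and $\max a_i\le p$. $\widetilde{F}_v(m;p;q)$ is the minimum number of vertices of a graph $G$ with $G \overset{v}{\rightarrow} \langle m\rangle_p$ and clique number $\omega(G)<q$ (it exists iff $q>\min\{m,p\}$). *)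

theory Defs
  imports "HOL-Library.Ramsey"
begin

text \<open>
  A graph is a vertex set \<^term>\<open>V\<close> with a set \<^term>\<open>E\<close> of two-element subsets of \<^term>\<open>V\<close>.
  As usual the vertex set is nonempty; without this, for \<open>p = 1 < m\<close> the null graph would be
  vacuously admissible below, even for \<open>q = 1 = min m p\<close>.
\<close>

definition simple_graph :: "'a set \<Rightarrow> 'a set set \<Rightarrow> bool" where
  "simple_graph V E \<longleftrightarrow> finite V \<and> V \<noteq> {} \<and> E \<subseteq> [V]\<^bsup>2\<^esup>"

definition clique_number :: "'a set \<Rightarrow> 'a set set \<Rightarrow> nat" where
  "clique_number V E = Max (card ` {K. K \<subseteq> V \<and> clique K E})"

text \<open>The tuple \<open>(a\<^sub>1, \<dots>, a\<^sub>s)\<close> is a list, and the colors are its indices \<open>0, \<dots>, s - 1\<close>.\<close>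

definition vertex_arrows :: "'a set \<Rightarrow> 'a set set \<Rightarrow> nat list \<Rightarrow> bool" where
  "vertex_arrows V E as \<longleftrightarrow>
     (\<forall>c \<in> V \<rightarrow> {..<length as}.
        \<exists>i < length as. \<exists>K \<subseteq> V. clique K E \<and> card K = as ! i \<and> (\<forall>v\<in>K. c v = i))"

definition vertex_arrows_all :: "'a set \<Rightarrow> 'a set set \<Rightarrow> nat \<Rightarrow> nat \<Rightarrow> bool" where
  "vertex_arrows_all V E m p \<longleftrightarrow>
     (\<forall>as. (\<forall>a\<in>set as. 1 \<le> a \<and> a \<le> p) \<and> (\<Sum>a\<leftarrow>as. a - 1) + 1 = m
        \<longrightarrow> vertex_arrows V E as)"

text \<open>
  Every finite graph is isomorphic to one with vertices in \<^typ>\<open>nat\<close>. Such a graph exists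
  iff \<open>q > min m p\<close>; otherwise the value is unspecified.
\<close>

definition folkman_number :: "nat \<Rightarrow> nat \<Rightarrow> nat \<Rightarrow> nat" where
  "folkman_number m p q =
     (LEAST n. \<exists>(V :: nat set) E. simple_graph V E \<and> card V = n \<and>
        vertex_arrows_all V E m p \<and> clique_number V E < q)"

end

theory Submission
  imports Defs
begin

text \<open>
  Joining a new vertex to all vertices of a graph raises both \<open>m\<close> and the clique number by one:
  if the new vertex has color \<open>i\<close>, lower \<open>a\<^sub>i\<close> by one and use the old graph. Iterating this on a
  minimal graph gives the bound, provided a minimal graph exists at all. This is Folkman's theorem:
  for all \<open>p, r > 0\<close> there is a graph with clique number \<open>p\<close> such that every \<open>r\<close>-coloring of its
  vertices has a monochromatic \<open>p\<close>-clique.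

  Folkman's theorem is proved by partite amalgamation. Start with an \<open>rp\<close>-partite graph that
  contains a \<open>p\<close>-clique on every \<open>p\<close> of its parts; by pigeonhole it has the required property for
  colorings that are constant on each part. To drop the constancy assumption for one part \<open>X\<close>,
  replace \<open>X\<close> by a set \<open>Y\<close> with \<open>r |X|\<close> points and glue a copy of the graph onto every
  injection of \<open>X\<close> into \<open>Y\<close>, the other parts staying disjoint. As \<open>Y\<close> is independent, each clique
  lies within a single copy.
\<close>

section \<open>Folkman's theorem\<close>

lemma pigeonhole_monochromatic_subset:
  fixes c :: "'a \<Rightarrow> nat"
  assumes "finite A" "card A = r * n" "r > 0" "c \<in> A \<rightarrow> {..<r}"
  obtains k S where "S \<subseteq> A" "card S = n" "\<And>x. x \<in> S \<Longrightarrow> c x = k"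
proof -
  have "\<exists>k<r. n \<le> card {x\<in>A. c x = k}"
  proof (rule ccontr)
    assume "\<not> ?thesis"
    then have less: "card {x\<in>A. c x = k} < n" if "k < r" for k
      using that by (meson not_le)
    have "(\<Union>k<r. {x\<in>A. c x = k}) = A"
      using assms(4) by auto
    then have "card A \<le> (\<Sum>k<r. card {x\<in>A. c x = k})"
      using card_UN_le[of "{..<r}" "\<lambda>k. {x\<in>A. c x = k}"] by simp
    also have "\<dots> < (\<Sum>k<r. n)"
      using less \<open>r > 0\<close> by (intro sum_strict_mono) auto
    finally show False
      using assms(2) by simp
  qed
  then obtain k where "n \<le> card {x\<in>A. c x = k}" by blast
  then obtain S where "S \<subseteq> {x\<in>A. c x = k}" "card S = n"
    by (meson obtain_subset_with_card_n)
  then show thesis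
    by (intro that[of S k]) auto
qed

text \<open>
  The graph has vertex set \<open>V\<close>, adjacency \<open>R\<close> and independent parts, the fibres of \<open>f\<close>. Only
  colorings that are constant on the parts with index at least \<open>i\<close> are considered.
\<close>

definition partite_folkman ::
  "nat \<Rightarrow> nat \<Rightarrow> nat \<Rightarrow> 'a set \<Rightarrow> ('a \<Rightarrow> 'a \<Rightarrow> bool) \<Rightarrow> ('a \<Rightarrow> nat) \<Rightarrow> bool" where
  "partite_folkman p r i V R f \<longleftrightarrow>
     finite V \<and>
     (\<forall>x\<in>V. \<forall>y\<in>V. R x y \<longrightarrow> f x \<noteq> f y) \<and>
     (\<forall>K\<subseteq>V. pairwise R K \<longrightarrow> card K \<le> p) \<and>
     (\<forall>c \<in> V \<rightarrow> {..<r}.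
        (\<forall>x\<in>V. \<forall>y\<in>V. f x = f y \<and> i \<le> f x \<longrightarrow> c x = c y) \<longrightarrow>
        (\<exists>K\<subseteq>V. pairwise R K \<and> card K = p \<and> (\<exists>k. \<forall>v\<in>K. c v = k)))"

lemma partite_folkmanD:
  assumes "partite_folkman p r i V R f"
  shows "finite V"
    and "\<And>x y. x \<in> V \<Longrightarrow> y \<in> V \<Longrightarrow> R x y \<Longrightarrow> f x \<noteq> f y"
    and "\<And>K. K \<subseteq> V \<Longrightarrow> pairwise R K \<Longrightarrow> card K \<le> p"
    and "\<And>c. c \<in> V \<rightarrow> {..<r} \<Longrightarrow>
      (\<And>x y. x \<in> V \<Longrightarrow> y \<in> V \<Longrightarrow> f x = f y \<Longrightarrow> i \<le> f x \<Longrightarrow> c x = c y) \<Longrightarrow>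
      \<exists>K\<subseteq>V. pairwise R K \<and> card K = p \<and> (\<exists>k. \<forall>v\<in>K. c v = k)"
proof -
  note def = assms[unfolded partite_folkman_def]
  show "finite V"
    using def by (rule conjunct1)
  show "f x \<noteq> f y" if "x \<in> V" "y \<in> V" "R x y" for x y
    using def[THEN conjunct2, THEN conjunct1] that by simp
  show "card K \<le> p" if "K \<subseteq> V" "pairwise R K" for K
    using def[THEN conjunct2, THEN conjunct2, THEN conjunct1] that by simp
  show "\<exists>K\<subseteq>V. pairwise R K \<and> card K = p \<and> (\<exists>k. \<forall>v\<in>K. c v = k)"
    if "c \<in> V \<rightarrow> {..<r}"
      and const: "\<And>x y. x \<in> V \<Longrightarrow> y \<in> V \<Longrightarrow> f x = f y \<Longrightarrow> i \<le> f x \<Longrightarrow> c x = c y" for c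
  proof (rule def[THEN conjunct2, THEN conjunct2, THEN conjunct2, THEN bspec, THEN mp])
    show "\<forall>x\<in>V. \<forall>y\<in>V. f x = f y \<and> i \<le> f x \<longrightarrow> c x = c y"
      by (intro ballI impI, elim conjE) (rule const)
  qed fact
qed

lemma partite_folkmanI:
  assumes "finite V"
    and "\<And>x y. x \<in> V \<Longrightarrow> y \<in> V \<Longrightarrow> R x y \<Longrightarrow> f x \<noteq> f y"
    and "\<And>K. K \<subseteq> V \<Longrightarrow> pairwise R K \<Longrightarrow> card K \<le> p"
    and "\<And>c. c \<in> V \<rightarrow> {..<r} \<Longrightarrow>
      (\<And>x y. x \<in> V \<Longrightarrow> y \<in> V \<Longrightarrow> f x = f y \<Longrightarrow> i \<le> f x \<Longrightarrow> c x = c y) \<Longrightarrow>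
      \<exists>K\<subseteq>V. pairwise R K \<and> card K = p \<and> (\<exists>k. \<forall>v\<in>K. c v = k)"
  shows "partite_folkman p r i V R f"
  unfolding partite_folkman_def
proof (intro conjI ballI allI impI)
  show "\<exists>K\<subseteq>V. pairwise R K \<and> card K = p \<and> (\<exists>k. \<forall>v\<in>K. c v = k)"
    if c: "c \<in> V \<rightarrow> {..<r}"
      and const: "\<forall>x\<in>V. \<forall>y\<in>V. f x = f y \<and> i \<le> f x \<longrightarrow> c x = c y" for c
  proof (rule assms(4)[OF c])
    show "c x = c y" if "x \<in> V" "y \<in> V" "f x = f y" "i \<le> f x" for x y
      using const[THEN bspec, OF that(1), THEN bspec, OF that(2)] that(3,4) by iprover
  qed
qed (fact assms(1), erule (2) assms(2), erule (1) assms(3))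

text \<open>Amalgamation changes the vertex type, so each result is moved back to \<open>nat\<close>
  before amalgamating again. Colorings of \<open>V'\<close> become colorings of \<open>V\<close> by
  composition with \<open>g\<close>, the inverse of the bijection \<open>h\<close>, and the clique
  found in \<open>V\<close> is mapped back by \<open>g\<close>. The inclusion of images keeps
  control of the part indices.\<close>

lemma partite_folkman_nat:
  assumes "partite_folkman p r i V R f"
  shows "\<exists>(V' :: nat set) R' f'. partite_folkman p r i V' R' f' \<and> f' ` V' \<subseteq> f ` V"
proof -
  note fin = partite_folkmanD(1)[OF assms] and indep = partite_folkmanD(2)[OF assms]
    and cliques = partite_folkmanD(3)[OF assms] and mono = partite_folkmanD(4)[OF assms]
  define V' where "V' = {..<card V}"
  obtain h where h: "bij_betw h V' V"
    unfolding V'_def lessThan_atLeast0 using ex_bij_betw_nat_finite[OF fin] by blast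
  define g where "g = the_inv_into V' h"
  have hV: "h x \<in> V" if "x \<in> V'" for x
    using h that by (auto simp: bij_betw_def)
  have gV: "g v \<in> V'" and hg: "h (g v) = v" if "v \<in> V" for v
    using h that by (auto simp: g_def bij_betw_def the_inv_into_into f_the_inv_into_f)
  define R' where "R' x y = R (h x) (h y)" for x y
  have "partite_folkman p r i V' R' (f \<circ> h)"
  proof (rule partite_folkmanI)
    show "finite V'" by (simp add: V'_def)
    show "(f \<circ> h) x \<noteq> (f \<circ> h) y" if "x \<in> V'" "y \<in> V'" "R' x y" for x y
      using indep hV that by (auto simp: R'_def)
    show "card K \<le> p" if K: "K \<subseteq> V'" "pairwise R' K" for K
    proof -
      have "inj_on h K"
        using h K(1) by (auto simp: bij_betw_def intro: inj_on_subset)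
      then have "card (h ` K) = card K"
        by (rule card_image)
      moreover have "pairwise R (h ` K)"
        using K(2) by (auto simp: pairwise_def R'_def)
      ultimately show ?thesis
        using cliques[of "h ` K"] K(1) hV by auto
    qed
    show "\<exists>K\<subseteq>V'. pairwise R' K \<and> card K = p \<and> (\<exists>k. \<forall>v\<in>K. c v = k)"
      if c: "c \<in> V' \<rightarrow> {..<r}"
        and const: "\<And>x y. x \<in> V' \<Longrightarrow> y \<in> V' \<Longrightarrow> (f \<circ> h) x = (f \<circ> h) y \<Longrightarrow> i \<le> (f \<circ> h) x \<Longrightarrow> c x = c y" for c
    proof -
      have "(\<lambda>v. c (g v)) \<in> V \<rightarrow> {..<r}"
        using c gV by auto
      moreover have "c (g x) = c (g y)" if "x \<in> V" "y \<in> V" "f x = f y" "i \<le> f x" for x y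
        using const[of "g x" "g y"] gV hg that by simp
      ultimately obtain K k where K: "K \<subseteq> V" "pairwise R K" "card K = p" "\<forall>v\<in>K. c (g v) = k"
        using mono[of "\<lambda>v. c (g v)"] by blast
      have "inj_on g K"
        using K(1) hg by (metis inj_on_def subsetD)
      then have "card (g ` K) = p"
        using K(3) by (simp add: card_image)
      moreover have "pairwise R' (g ` K)"
        using K(1,2) hg by (auto simp: pairwise_def R'_def subset_iff)
      ultimately show ?thesis
        using K gV by (intro exI[of _ "g ` K"]) auto
    qed
  qed
  then show ?thesis
    using hV by (intro exI[of _ V'] exI[of _ R'] exI[of _ "f \<circ> h"]) auto
qed

section \<open>The initial graph and the amalgamation of one part\<close>

lemma partite_folkman_base:
  assumes "p > 0" "r > 0"
  shows "\<exists>(V :: (nat set \<times> nat) set) R f. partite_folkman p r 0 V R f \<and> f ` V \<subseteq> {..<r * p}"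
proof -
  define V where "V = {(S, j). S \<subseteq> {..<r * p} \<and> card S \<le> p \<and> j \<in> S}"
  define R where "R = (\<lambda>(S :: nat set, j) (T, k). S = T \<and> j \<noteq> (k :: nat))"
  have "partite_folkman p r 0 V R snd"
  proof (rule partite_folkmanI)
    have "V \<subseteq> Pow {..<r * p} \<times> {..<r * p}"
      by (auto simp: V_def)
    then show "finite V"
      by (rule finite_subset) auto
    show "snd x \<noteq> snd y" if "R x y" for x y
      using that by (auto simp: R_def)
    show "card K \<le> p" if K: "K \<subseteq> V" "pairwise R K" for K
    proof (cases "K = {}")
      case False
      then obtain S j where Sj: "(S, j) \<in> K" by auto
      \<comment> \<open>Adjacent vertices share their first component, so a clique lies in one
        block.\<close>
      have "K \<subseteq> {S} \<times> S"
      proof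
        fix x assume "x \<in> K"
        then have "fst x = S"
          using pairwiseD[OF K(2) \<open>x \<in> K\<close> Sj]
          by (cases "x = (S, j)") (auto simp: R_def split: prod.splits)
        then show "x \<in> {S} \<times> S"
          using \<open>x \<in> K\<close> K(1) by (auto simp: V_def)
      qed
      moreover have "finite S" "card S \<le> p"
        using Sj K(1) finite_subset[of S "{..<r * p}"] by (auto simp: V_def)
      ultimately show ?thesis
        using card_mono[of "{S} \<times> S" K] by (simp add: card_cartesian_product)
    qed simp
    show "\<exists>K\<subseteq>V. pairwise R K \<and> card K = p \<and> (\<exists>k. \<forall>v\<in>K. c v = k)"
      if c: "c \<in> V \<rightarrow> {..<r}"
        and const: "\<And>x y. x \<in> V \<Longrightarrow> y \<in> V \<Longrightarrow> snd x = snd y \<Longrightarrow> 0 \<le> snd x \<Longrightarrow> c x = c y" for c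
    proof -
      have sing: "({j}, j) \<in> V" if "j < r * p" for j
        using that \<open>p > 0\<close> by (auto simp: V_def)
      then have "(\<lambda>j. c ({j}, j)) \<in> {..<r * p} \<rightarrow> {..<r}"
        using c by auto
      then obtain S k where S: "S \<subseteq> {..<r * p}" "card S = p" "\<And>j. j \<in> S \<Longrightarrow> c ({j}, j) = k"
        using \<open>r > 0\<close> by (elim pigeonhole_monochromatic_subset[rotated 3]) auto
      have sub: "{S} \<times> S \<subseteq> V"
        using S by (auto simp: V_def)
      moreover have "c v = k" if "v \<in> {S} \<times> S" for v
      proof -
        have "c v = c ({snd v}, snd v)"
          using sub sing[of "snd v"] that S(1) by (intro const) auto
        then show ?thesis using S(3) that by auto
      qed
      moreover have "pairwise R ({S} \<times> S)"
        by (auto simp: pairwise_def R_def)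
      ultimately show ?thesis
        using S(2) by (intro exI[of _ "{S} \<times> S"]) (auto simp: card_cartesian_product)
    qed
  qed
  moreover have "snd ` V \<subseteq> {..<r * p}"
    by (auto simp: V_def)
  ultimately show ?thesis
    by blast
qed

text \<open>Points of the shared part \<open>Y\<close> are tagged \<open>Inl\<close>;
  \<open>Inr (e, v)\<close> is the private copy of \<open>v\<close> belonging to the injection
  \<open>e\<close>. The part index of a copy does not depend on \<open>e\<close>, so a coloring
  constant on the parts above \<open>i\<close> of the new graph restricts to such a coloring on
  every copy. Part \<open>i\<close> is handled by choosing the copy.\<close>

lemma partite_folkman_step:
  fixes V :: "'a set"
  assumes "partite_folkman p r i V R f" "p > 0" "r > 0"
  shows "\<exists>(W :: (nat + ('a \<Rightarrow> nat) \<times> 'a) set) R' f'.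
    partite_folkman p r (Suc i) W R' f' \<and> f' ` W \<subseteq> insert i (f ` V)"
proof -
  note fin = partite_folkmanD(1)[OF assms(1)] and indep = partite_folkmanD(2)[OF assms(1)]
    and cliques = partite_folkmanD(3)[OF assms(1)] and mono = partite_folkmanD(4)[OF assms(1)]
  define X where "X = {v\<in>V. f v = i}"
  \<comment> \<open>With \<open>r\<close> colors, this many points force \<open>card X\<close>
    points of one color.\<close>
  define Y where "Y = {..<r * card X}"
  \<comment> \<open>Extensional functions keep \<open>I\<close>, and with it \<open>W\<close>,
    finite.\<close>
  define I where "I = {e \<in> X \<rightarrow>\<^sub>E Y. inj_on e X}"
  define emb :: "('a \<Rightarrow> nat) \<Rightarrow> 'a \<Rightarrow> nat + ('a \<Rightarrow> nat) \<times> 'a"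
    where "emb e v = (if f v = i then Inl (e v) else Inr (e, v))" for e v
  define W where "W = Inl ` Y \<union> (\<Union>e\<in>I. emb e ` V)"
  define R' where "R' w w' \<longleftrightarrow> (\<exists>e\<in>I. \<exists>v\<in>V. \<exists>v'\<in>V. w = emb e v \<and> w' = emb e v' \<and> R v v')"
    for w w'
  define f' where "f' = case_sum (\<lambda>y :: nat. i) (\<lambda>(e :: 'a \<Rightarrow> nat, v). f v)"
  have f'_emb: "f' (emb e v) = f v" for e v
    by (simp add: f'_def emb_def)
  have inj_emb: "inj_on (emb e) V" if "e \<in> I" for e
    using that by (auto simp: inj_on_def emb_def I_def X_def)
  have "finite X" using fin by (simp add: X_def)
  have indep': "f' w \<noteq> f' w'" if "R' w w'" for w w'
    using that indep by (auto simp: R'_def f'_emb)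
  have "partite_folkman p r (Suc i) W R' f'"
  proof (rule partite_folkmanI)
    have "finite (X \<rightarrow>\<^sub>E Y)"
      using \<open>finite X\<close> by (intro finite_PiE) (auto simp: Y_def)
    then have "finite I"
      by (rule rev_finite_subset) (auto simp: I_def)
    then show "finite W"
      using fin by (auto simp: W_def Y_def)
    show "f' w \<noteq> f' w'" if "R' w w'" for w w'
      using that by (rule indep')
    show "card K \<le> p" if K: "K \<subseteq> W" "pairwise R' K" for K
    \<comment> \<open>All edges at a vertex \<open>Inr (e, v)\<close> stay in the copy of
      \<open>e\<close>, so a clique containing it pulls back along \<open>emb e\<close>. A clique
      without such a vertex lies in the independent part \<open>Y\<close> and has at most one
      point.\<close>
    proof (cases "\<exists>e v. Inr (e, v) \<in> K")
      case True
      then obtain e v where ev: "Inr (e, v) \<in> K" by blast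
      have "e \<in> I \<and> K \<subseteq> emb e ` V"
      proof
        show "e \<in> I"
          using ev K(1) by (auto simp: W_def emb_def split: if_splits)
        show "K \<subseteq> emb e ` V"
        proof
          fix w assume w: "w \<in> K"
          show "w \<in> emb e ` V"
          proof (cases "w = Inr (e, v)")
            case True
            then show ?thesis
              using ev K(1) by (auto simp: W_def emb_def image_iff split: if_splits)
          next
            case False
            then have "R' w (Inr (e, v))"
              using K(2) ev w by (auto simp: pairwise_def)
            then show ?thesis
              by (auto simp: R'_def emb_def split: if_splits)
          qed
        qed
      qed
      then have e: "e \<in> I" and sub: "K \<subseteq> emb e ` V" by auto
      define L where "L = {v\<in>V. emb e v \<in> K}"
      have "K = emb e ` L"
        using sub by (auto simp: L_def)
      moreover have "inj_on (emb e) L"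
        using inj_emb[OF e] by (rule inj_on_subset) (auto simp: L_def)
      ultimately have "card K = card L"
        by (simp add: card_image)
      moreover have "pairwise R L"
      proof (rule pairwiseI)
        fix x y assume xy: "x \<in> L" "y \<in> L" "x \<noteq> y"
        then have "emb e x \<noteq> emb e y"
          using inj_emb[OF e] by (auto simp: L_def inj_on_def)
        then have "R' (emb e x) (emb e y)"
          using K(2) xy by (auto simp: pairwise_def L_def)
        then obtain d u v where d: "d \<in> I" "u \<in> V" "v \<in> V" "emb e x = emb d u" "emb e y = emb d v"
            "R u v"
          by (auto simp: R'_def)
        \<comment> \<open>The edge might stem from another copy \<open>d\<close>. Its ends lie in
          different parts, so one of them is outside part \<open>i\<close>; being tagged
          \<open>Inr\<close>, it identifies the copy.\<close>
        have "f u \<noteq> f v" using d indep by blast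
        then have "d = e"
          using d(4,5) by (auto simp: emb_def split: if_splits)
        then have "u = x" "v = y"
          using d inj_emb[OF e] xy by (auto simp: L_def inj_on_def)
        then show "R x y" using d by simp
      qed
      ultimately show ?thesis
        using cliques[of L] by (auto simp: L_def)
    next
      case False
      have "x = y" if "x \<in> K" "y \<in> K" for x y
      proof (rule ccontr)
        assume "x \<noteq> y"
        then have "f' x \<noteq> f' y"
          using K(2) that indep' by (auto simp: pairwise_def)
        then show False
          using False that by (cases x; cases y) (auto simp: f'_def)
      qed
      then have "card K \<le> 1"
        by (metis One_nat_def card.infinite card_le_Suc0_iff_eq zero_le)
      then show ?thesis using \<open>p > 0\<close> by simp
    qed
    show "\<exists>K\<subseteq>W. pairwise R' K \<and> card K = p \<and> (\<exists>k. \<forall>v\<in>K. c v = k)"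
      if c: "c \<in> W \<rightarrow> {..<r}"
        and const: "\<And>x y. x \<in> W \<Longrightarrow> y \<in> W \<Longrightarrow> f' x = f' y \<Longrightarrow> Suc i \<le> f' x \<Longrightarrow> c x = c y" for c
    proof -
      have "(\<lambda>y. c (Inl y)) \<in> Y \<rightarrow> {..<r}"
        using c by (auto simp: W_def)
      then obtain S k where S: "S \<subseteq> Y" "card S = card X" "\<And>y. y \<in> S \<Longrightarrow> c (Inl y) = k"
        using \<open>r > 0\<close> by (elim pigeonhole_monochromatic_subset[rotated 3]) (auto simp: Y_def)
      have "finite S" using S(1) finite_subset by (auto simp: Y_def)
      then obtain h where h: "bij_betw h X S"
        using finite_same_card_bij[OF \<open>finite X\<close>] S(2) by metis
      \<comment> \<open>This injection selects the copy whose part \<open>i\<close> is sent onto the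
        monochromatic set \<open>S\<close>.\<close>
      define e where "e = restrict h X"
      have eS: "e x \<in> S" if "x \<in> X" for x
        using h that by (auto simp: e_def bij_betw_def)
      have e: "e \<in> I"
        using h S(1) by (auto simp: I_def e_def bij_betw_def inj_on_def)
      have embW: "emb e v \<in> W" if "v \<in> V" for v
        using e that by (auto simp: W_def)
      \<comment> \<open>On part \<open>i\<close> constancy comes from the choice of
        \<open>S\<close>; above \<open>i\<close> it comes from the assumption on
        \<open>c\<close>.\<close>
      have "c (emb e x) = c (emb e y)" if "x \<in> V" "y \<in> V" "f x = f y" "i \<le> f x" for x y
      proof (cases "f x = i")
        case True
        then show ?thesis
          using that eS S(3) by (auto simp: emb_def X_def)
      next
        case False
        then show ?thesis
          using that embW by (intro const) (auto simp: f'_emb)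
      qed
      moreover have "(\<lambda>v. c (emb e v)) \<in> V \<rightarrow> {..<r}"
        using c embW by auto
      ultimately obtain K k where K: "K \<subseteq> V" "pairwise R K" "card K = p" "\<forall>v\<in>K. c (emb e v) = k"
        using mono[of "\<lambda>v. c (emb e v)"] by blast
      have "inj_on (emb e) K"
        using inj_emb[OF e] K(1) by (rule inj_on_subset)
      then have "card (emb e ` K) = p"
        using K(3) by (simp add: card_image)
      moreover have "pairwise R' (emb e ` K)"
      proof (rule pairwise_imageI)
        fix x y assume "x \<in> K" "y \<in> K" "x \<noteq> y"
        then have "x \<in> V" "y \<in> V" "R x y"
          using K(1,2) by (auto simp: pairwise_def)
        then show "R' (emb e x) (emb e y)"
          unfolding R'_def using e by blast
      qed
      ultimately show ?thesis
        using K embW by (intro exI[of _ "emb e ` K"]) auto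
    qed
  qed
  moreover have "f' ` W \<subseteq> insert i (f ` V)"
    by (auto simp: W_def f'_emb) (auto simp: f'_def)
  ultimately show ?thesis
    by blast
qed

section \<open>Folkman's theorem for arbitrary vertex colorings\<close>

text \<open>For \<open>i = 0\<close> colorings must be constant on every part. Each amalgamation
  frees one more part, and all part indices stay below \<open>r * p\<close>, so at
  \<open>i = r * p\<close> the constancy condition is vacuous.\<close>

lemma folkman_clique_coloring:
  fixes p r :: nat
  assumes "p > 0" "r > 0"
  obtains V :: "nat set" and R where "finite V"
    and "\<And>K. K \<subseteq> V \<Longrightarrow> pairwise R K \<Longrightarrow> card K \<le> p"
    and "\<And>c. c \<in> V \<rightarrow> {..<r} \<Longrightarrow>
      \<exists>K\<subseteq>V. pairwise R K \<and> card K = p \<and> (\<exists>k. \<forall>v\<in>K. c v = k)"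
proof -
  have "\<exists>(V :: nat set) R f. partite_folkman p r i V R f \<and> f ` V \<subseteq> {..<r * p}" if "i \<le> r * p" for i
    using that
  proof (induction i)
    case 0
    obtain V :: "(nat set \<times> nat) set" and R f
      where V: "partite_folkman p r 0 V R f" "f ` V \<subseteq> {..<r * p}"
      using partite_folkman_base[OF assms] by blast
    show ?case
      using partite_folkman_nat[OF V(1)] V(2) by (meson order_trans)
  next
    case (Suc i)
    then obtain V :: "nat set" and R f
      where V: "partite_folkman p r i V R f" "f ` V \<subseteq> {..<r * p}"
      by auto
    obtain W :: "(nat + (nat \<Rightarrow> nat) \<times> nat) set" and R' f'
      where W: "partite_folkman p r (Suc i) W R' f'" "f' ` W \<subseteq> insert i (f ` V)"
      using partite_folkman_step[OF V(1) assms] by blast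
    have "f' ` W \<subseteq> {..<r * p}"
      using W(2) V(2) Suc.prems by (meson Suc_le_lessD insert_subset lessThan_iff order_trans)
    then show ?case
      using partite_folkman_nat[OF W(1)] by (meson order_trans)
  qed
  from this[of "r * p"] obtain V :: "nat set" and R f
    where V: "partite_folkman p r (r * p) V R f" "f ` V \<subseteq> {..<r * p}"
    by auto
  have "\<not> r * p \<le> f x" if "x \<in> V" for x
    using V(2) that by (auto simp: not_le)
  then show thesis
    using partite_folkmanD[OF V(1)] by (intro that[of V R]) simp_all
qed

section \<open>Modified vertex Folkman numbers\<close>

lemma clique_number_less_iff:
  assumes "finite V"
  shows "clique_number V E < q \<longleftrightarrow> (\<forall>K\<subseteq>V. clique K E \<longrightarrow> card K < q)"
proof -
  have "clique {} E" by (simp add: clique_def)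
  then have "{K. K \<subseteq> V \<and> clique K E} \<noteq> {}" by blast
  then show ?thesis
    using assms by (auto simp: clique_number_def)
qed

definition folkman_graph :: "nat \<Rightarrow> nat \<Rightarrow> nat \<Rightarrow> 'a set \<Rightarrow> 'a set set \<Rightarrow> bool" where
  "folkman_graph m p q V E \<longleftrightarrow>
     simple_graph V E \<and> vertex_arrows_all V E m p \<and> clique_number V E < q"

text \<open>Folkman's theorem is applied with \<open>m\<close> colors and cliques of size
  \<open>min m p\<close>. This serves all tuples at once: entries equal to 1 are met by single
  vertices, the other entries each contribute at least 1 to a sum of \<open>m - 1\<close>, so there
  are fewer than \<open>m\<close> of them, and every entry is at most
  \<open>min m p\<close>.\<close>

lemma folkman_graph_exists:
  assumes "m > 0" "p > 0" "q > min m p"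
  shows "\<exists>(V :: nat set) E. folkman_graph m p q V E"
proof -
  define s where "s = min m p"
  have "s > 0" using assms by (simp add: s_def)
  obtain V :: "nat set" and R where fin: "finite V"
    and cliques: "\<And>K. K \<subseteq> V \<Longrightarrow> pairwise R K \<Longrightarrow> card K \<le> s"
    and mono: "\<And>c. c \<in> V \<rightarrow> {..<m} \<Longrightarrow>
      \<exists>K\<subseteq>V. pairwise R K \<and> card K = s \<and> (\<exists>k. \<forall>v\<in>K. c v = k)"
    using folkman_clique_coloring[OF \<open>s > 0\<close> \<open>m > 0\<close>] by metis
  \<comment> \<open>\<open>R\<close> may be asymmetric, but \<open>pairwise\<close> asks for both
    directions, so keeping only mutual pairs preserves the cliques.\<close>
  define E where "E = {{x, y} | x y. x \<in> V \<and> y \<in> V \<and> x \<noteq> y \<and> R x y \<and> R y x}"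
  have clique_iff: "clique K E \<longleftrightarrow> pairwise R K" if "K \<subseteq> V" for K
  proof -
    have "{x, y} \<in> E \<longleftrightarrow> R x y \<and> R y x" if "x \<in> K" "y \<in> K" "x \<noteq> y" for x y
      using that \<open>K \<subseteq> V\<close> by (auto simp: E_def doubleton_eq_iff)
    then show ?thesis
      unfolding clique_def pairwise_def by metis
  qed
  have "V \<noteq> {}"
    using mono[of "\<lambda>_. 0"] \<open>s > 0\<close> \<open>m > 0\<close> by auto
  moreover have "E \<subseteq> [V]\<^bsup>2\<^esup>"
    by (auto simp: E_def nsets_def)
  moreover have "clique_number V E < q"
    using cliques assms(3) clique_iff unfolding clique_number_less_iff[OF fin] s_def
    by (meson le_less_trans)
  moreover have "vertex_arrows V E as"
    if as: "\<forall>a\<in>set as. 1 \<le> a \<and> a \<le> p" "(\<Sum>a\<leftarrow>as. a - 1) + 1 = m" for as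
    unfolding vertex_arrows_def
  proof
    fix c assume c: "c \<in> V \<rightarrow> {..<length as}"
    show "\<exists>i<length as. \<exists>K\<subseteq>V. clique K E \<and> card K = as ! i \<and> (\<forall>v\<in>K. c v = i)"
    proof (cases "\<exists>v\<in>V. as ! c v = 1")
      case True
      then obtain v where "v \<in> V" "as ! c v = 1" by blast
      then show ?thesis
        using c by (intro exI[of _ "c v"] conjI exI[of _ "{v}"]) (auto simp: clique_def)
    next
      case False
      define J where "J = {i. i < length as \<and> as ! i \<noteq> 1}"
      have sum: "(\<Sum>a\<leftarrow>as. a - 1) = (\<Sum>i<length as. as ! i - 1)"
        by (simp add: sum_list_sum_nth atLeast0LessThan)
      have le: "1 \<le> as ! i" "as ! i \<le> p" if "i < length as" for i
        using as(1) that by auto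
      have "card J = (\<Sum>i\<in>J. 1)" by simp
      also have "\<dots> \<le> (\<Sum>i\<in>J. as ! i - 1)"
        using le by (intro sum_mono) (fastforce simp: J_def)
      also have "\<dots> \<le> (\<Sum>i<length as. as ! i - 1)"
        by (intro sum_mono2) (auto simp: J_def)
      finally have "card J \<le> card {..<m}"
        using sum as(2) by simp
      moreover have "finite J" by (simp add: J_def)
      \<comment> \<open>Renaming the colors in \<open>J\<close> injectively turns \<open>c\<close>
        into an \<open>m\<close>-coloring with the same color classes.\<close>
      ultimately obtain g where g: "inj_on g J" "g ` J \<subseteq> {..<m}"
        using card_le_inj[of J "{..<m}"] by auto
      have cJ: "c v \<in> J" if "v \<in> V" for v
        using False c that by (auto simp: J_def)
      then obtain K k where K: "K \<subseteq> V" "pairwise R K" "card K = s" "\<forall>v\<in>K. g (c v) = k"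
        using mono[of "\<lambda>v. g (c v)"] g(2) by blast
      obtain v where v: "v \<in> K"
        using K(3) \<open>s > 0\<close> by fastforce
      have same: "c w = c v" if "w \<in> K" for w
        using g(1) cJ K v that by (metis inj_onD subsetD)
      have i: "c v < length as"
        using c v K(1) by auto
      then have "as ! c v - 1 \<le> (\<Sum>i<length as. as ! i - 1)"
        by (intro member_le_sum) auto
      then have "as ! c v \<le> s"
        using le[OF i] sum as(2) by (simp add: s_def)
      \<comment> \<open>The monochromatic clique may be larger than required, so it is trimmed to
        the exact size.\<close>
      then obtain L where L: "L \<subseteq> K" "card L = as ! c v"
        using K(3) by (metis obtain_subset_with_card_n)
      have "clique L E"
        using L(1) K(1,2) clique_iff[of L] pairwise_subset by blast
      then show ?thesis
        using i L same K(1) by (intro exI[of _ "c v"] conjI exI[of _ L]) auto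
    qed
  qed
  ultimately have "folkman_graph m p q V E"
    using fin by (simp add: folkman_graph_def simple_graph_def vertex_arrows_all_def)
  then show ?thesis by blast
qed

section \<open>Cones over admissible graphs and the inequality\<close>

lemma folkman_graph_cone:
  assumes "folkman_graph m p q V E" "w \<notin> V"
  shows "folkman_graph (Suc m) p (Suc q) (insert w V) (E \<union> (\<lambda>v. {w, v}) ` V)"
    (is "folkman_graph _ _ _ ?V ?E")
proof -
  have fin: "finite V" and E: "E \<subseteq> [V]\<^bsup>2\<^esup>" and arrows: "vertex_arrows_all V E m p"
    and cn: "\<And>K. K \<subseteq> V \<Longrightarrow> clique K E \<Longrightarrow> card K < q"
    using assms(1) clique_number_less_iff[of V E q]
    by (auto simp: folkman_graph_def simple_graph_def)
  have clique_iff: "clique K ?E \<longleftrightarrow> clique K E" if "K \<subseteq> V" for K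
  proof -
    have "{x, y} \<notin> (\<lambda>v. {w, v}) ` V" if "x \<in> K" "y \<in> K" for x y
      using that \<open>K \<subseteq> V\<close> assms(2) by (auto simp: doubleton_eq_iff)
    then show ?thesis
      unfolding clique_def by blast
  qed
  have clique_insert: "clique (insert w K) ?E" if "K \<subseteq> V" "clique K E" for K
    using that unfolding clique_def by (auto simp: insert_commute)
  have "?E \<subseteq> [?V]\<^bsup>2\<^esup>"
    using E assms(2) by (auto simp: nsets_def card_insert_if)
  then have "simple_graph ?V ?E"
    using fin by (simp add: simple_graph_def)
  moreover have "card K < Suc q" if K: "K \<subseteq> ?V" "clique K ?E" for K
  proof -
    have "K - {w} \<subseteq> V" using K(1) by auto
    moreover have "clique (K - {w}) ?E"
      using K(2) by (auto simp: clique_def)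
    ultimately have "card (K - {w}) < q"
      using cn clique_iff by blast
    moreover have "finite K"
      using K(1) fin finite_subset by blast
    ultimately show ?thesis
      by (cases "w \<in> K") (auto simp: card_Diff_singleton)
  qed
  moreover have "vertex_arrows ?V ?E as"
    if as: "\<forall>a\<in>set as. 1 \<le> a \<and> a \<le> p" "(\<Sum>a\<leftarrow>as. a - 1) + 1 = Suc m" for as
    unfolding vertex_arrows_def
  proof
    fix c assume c: "c \<in> ?V \<rightarrow> {..<length as}"
    define i where "i = c w"
    have i: "i < length as" using c by (auto simp: i_def)
    have "as ! i \<ge> 1" using as(1) i by auto
    show "\<exists>i<length as. \<exists>K\<subseteq>?V. clique K ?E \<and> card K = as ! i \<and> (\<forall>v\<in>K. c v = i)"
    \<comment> \<open>Lowering an entry 1 would leave the positive integers; in that case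
      \<open>w\<close> alone is the clique.\<close>
    proof (cases "as ! i = 1")
      case True
      then show ?thesis
        using i by (intro exI[of _ i] conjI exI[of _ "{w}"]) (auto simp: clique_def i_def)
    next
      case False
      define bs where "bs = as[i := as ! i - 1]"
      \<comment> \<open>Both sums are split at index \<open>i\<close>. Since \<open>as ! i\<close>
        is at least 2 here, truncated subtraction is exact and the sum drops by exactly one.\<close>
      have "(\<Sum>a\<leftarrow>as. a - 1) = (as ! i - 1) + (\<Sum>j\<in>{..<length as} - {i}. as ! j - 1)"
        using i by (simp add: sum_list_sum_nth atLeast0LessThan sum.remove[of _ i])
      moreover have "(\<Sum>a\<leftarrow>bs. a - 1) = (bs ! i - 1) + (\<Sum>j\<in>{..<length as} - {i}. bs ! j - 1)"
        using i by (simp add: sum_list_sum_nth atLeast0LessThan sum.remove[of _ i] bs_def)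
      moreover have "(\<Sum>j\<in>{..<length as} - {i}. bs ! j - 1) = (\<Sum>j\<in>{..<length as} - {i}. as ! j - 1)"
        by (intro sum.cong) (auto simp: bs_def)
      moreover have "bs ! i = as ! i - 1" using i by (simp add: bs_def)
      ultimately have "(\<Sum>a\<leftarrow>bs. a - 1) + 1 = m"
        using as(2) False \<open>as ! i \<ge> 1\<close> by linarith
      moreover have "\<forall>a\<in>set bs. 1 \<le> a \<and> a \<le> p"
      proof
        fix a assume "a \<in> set bs"
        then have "a \<in> set as \<or> a = as ! i - 1"
          unfolding bs_def using set_update_subset_insert by fast
        moreover have "as ! i \<le> p" using as(1) i by auto
        ultimately show "1 \<le> a \<and> a \<le> p"
          using as(1) False \<open>as ! i \<ge> 1\<close> by auto
      qed
      ultimately have "vertex_arrows V E bs"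
        using arrows by (simp add: vertex_arrows_all_def)
      moreover have "c \<in> V \<rightarrow> {..<length bs}"
        using c by (auto simp: bs_def)
      ultimately obtain j K where K: "j < length bs" "K \<subseteq> V" "clique K E" "card K = bs ! j"
          "\<forall>v\<in>K. c v = j"
        unfolding vertex_arrows_def by blast
      show ?thesis
      \<comment> \<open>A clique of color \<open>i\<close> is one vertex short and is completed by
        \<open>w\<close>; for any other color the required size is unchanged.\<close>
      proof (cases "j = i")
        case True
        have "w \<notin> K" "finite K"
          using K(2) assms(2) fin finite_subset by auto
        then have "card (insert w K) = as ! i"
          using K(4) True \<open>as ! i \<ge> 1\<close> i by (simp add: bs_def)
        then show ?thesis
          using i K clique_insert True
          by (intro exI[of _ i] conjI exI[of _ "insert w K"]) (auto simp: i_def)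
      next
        case False
        then show ?thesis
          using K clique_iff by (intro exI[of _ j] conjI exI[of _ K]) (auto simp: bs_def)
      qed
    qed
  qed
  ultimately show ?thesis
    using fin clique_number_less_iff[of ?V ?E "Suc q"]
    by (simp add: folkman_graph_def vertex_arrows_all_def)
qed

lemma folkman_graph_iterated_cone:
  fixes V :: "nat set"
  assumes "folkman_graph m p q V E"
  shows "\<exists>(V' :: nat set) E'. folkman_graph (m + k) p (q + k) V' E' \<and> card V' = card V + k"
proof (induction k)
  case 0
  then show ?case using assms by auto
next
  case (Suc k)
  then obtain V' :: "nat set" and E'
    where V': "folkman_graph (m + k) p (q + k) V' E'" "card V' = card V + k"
    by blast
  then have "finite V'" by (simp add: folkman_graph_def simple_graph_def)
  then obtain w where "w \<notin> V'"
    using ex_new_if_finite infinite_UNIV_nat by blast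
  then have "folkman_graph (m + Suc k) p (q + Suc k) (insert w V') (E' \<union> (\<lambda>v. {w, v}) ` V')"
    and "card (insert w V') = card V + Suc k"
    using folkman_graph_cone[OF V'(1)] V'(2) \<open>finite V'\<close> by auto
  then show ?case by blast
qed

theorem theorem11:
  fixes m m\<^sub>0 p q :: nat
  assumes "m > 0" and "m\<^sub>0 > 0" and "p > 0" and "q > 0"
    and "m \<ge> m\<^sub>0" and "q > min m\<^sub>0 p"
  shows "folkman_number m p (m - m\<^sub>0 + q) \<le> folkman_number m\<^sub>0 p q + (m - m\<^sub>0)"
proof -
  have eq: "folkman_number m p q =
      (LEAST n. \<exists>(V :: nat set) E. folkman_graph m p q V E \<and> card V = n)" for m p q
    unfolding folkman_number_def folkman_graph_def by (rule arg_cong[where f = Least]) blast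
  \<comment> \<open>Existence ensures that the \<open>LEAST\<close> on the right is attained. On the
    left, any graph of the stated order suffices.\<close>
  have "\<exists>n (V :: nat set) E. folkman_graph m\<^sub>0 p q V E \<and> card V = n"
    using folkman_graph_exists assms by blast
  then have "\<exists>(V :: nat set) E. folkman_graph m\<^sub>0 p q V E \<and> card V = folkman_number m\<^sub>0 p q"
    unfolding eq by (rule LeastI_ex)
  then obtain V :: "nat set" and E
    where "folkman_graph m\<^sub>0 p q V E" and card_V: "card V = folkman_number m\<^sub>0 p q"
    by blast
  from folkman_graph_iterated_cone[OF this(1), of "m - m\<^sub>0"]
  have "\<exists>(V' :: nat set) E'. folkman_graph m p (m - m\<^sub>0 + q) V' E' \<and>
      card V' = folkman_number m\<^sub>0 p q + (m - m\<^sub>0)"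
    using \<open>m \<ge> m\<^sub>0\<close> card_V by (simp add: add.commute)
  then show ?thesis
    unfolding eq[of m] by (rule Least_le)
qed

end
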